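(* For each integer $n\ge 9$ there are at least $\max\{1,2^{\lfloor\frac{n-11}{2}\rfloor}\}$ pairwise non-isomorphic planar graphs $G$ on $n$ vertices with $\chi(G)=3$, $\Delta(G)=4$, ${\rm ivs_{\chi}}(G)=3$ and ${\rm vs_{\chi}}(G)=2$.
   Context: All graphs are finite and simple. $\chi(G)$ is the chromatic number and $\Delta(G)$ the maximum degree of $G$. The chromatic vertex stability ${\rm vs_{\chi}}(G)$ is the minimum size of a set $S\subseteq V(G)$ such that $\chi(G-S)=\chi(G)-1$. The independent chromatic vertex stability ${\rm ivs_{\chi}}(G)$ is the minimum size of an independent set $S\subseteq V(G)$ such that $\chi(G-S)=\chi(G)-1$. *)

theory Defs
  imports "HOL-Analysis.Analysis" "Graph_Theory.Digraph_Isomorphism"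
begin

text \<open>
  Finite simple graphs are the instances of the locale \<^locale>\<open>graph\<close>: finite symmetric digraphs
  without loops and parallel arcs, an edge \<open>uv\<close> being represented by the two arcs between
  \<open>u\<close> and \<open>v\<close>. The notions below are meant for such digraphs.
\<close>

definition proper_colouring :: "('a, 'b) pre_digraph \<Rightarrow> nat \<Rightarrow> ('a \<Rightarrow> nat) \<Rightarrow> bool" where
  "proper_colouring G k c \<longleftrightarrow>
     (\<forall>v \<in> verts G. c v < k) \<and> (\<forall>u v. u \<rightarrow>\<^bsub>G\<^esub> v \<longrightarrow> c u \<noteq> c v)"

definition chromatic_number :: "('a, 'b) pre_digraph \<Rightarrow> nat" where
  "chromatic_number G = (LEAST k. \<exists>c. proper_colouring G k c)"

text \<open>By symmetry the out-degree of a vertex is its number of neighbours.\<close>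

definition max_degree :: "('a, 'b) pre_digraph \<Rightarrow> nat" where
  "max_degree G = Max (out_degree G ` verts G)"

definition delete_verts :: "('a, 'b) pre_digraph \<Rightarrow> 'a set \<Rightarrow> ('a, 'b) pre_digraph" where
  "delete_verts G S = G \<restriction> (verts G - S)"

definition independent_set :: "('a, 'b) pre_digraph \<Rightarrow> 'a set \<Rightarrow> bool" where
  "independent_set G S \<longleftrightarrow> S \<subseteq> verts G \<and> (\<forall>u \<in> S. \<forall>v \<in> S. \<not> u \<rightarrow>\<^bsub>G\<^esub> v)"

text \<open>
  The condition \<open>\<chi>(G - S) = \<chi>(G) - 1\<close> is written without the truncated subtraction on \<^typ>\<open>nat\<close>.
\<close>

definition vs_chi :: "('a, 'b) pre_digraph \<Rightarrow> nat" where
  "vs_chi G = (LEAST k. \<exists>S \<subseteq> verts G. card S = k \<and>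
     chromatic_number (delete_verts G S) + 1 = chromatic_number G)"

definition ivs_chi :: "('a, 'b) pre_digraph \<Rightarrow> nat" where
  "ivs_chi G = (LEAST k. \<exists>S. independent_set G S \<and> card S = k \<and>
     chromatic_number (delete_verts G S) + 1 = chromatic_number G)"

text \<open>
  A drawing in the plane: \<open>p\<close> places the vertices at distinct points, and the edge \<open>uv\<close> is drawn as
  the simple arc \<open>\<gamma> {u, v}\<close> (one curve for both orientations) joining \<open>p u\<close> and \<open>p v\<close>. An arc
  meets the vertex points only in its ends, and two arcs meet at most in common ends.
\<close>

definition plane_drawing ::
    "('a, 'b) pre_digraph \<Rightarrow> ('a \<Rightarrow> complex) \<Rightarrow> ('a set \<Rightarrow> real \<Rightarrow> complex) \<Rightarrow> bool" where
  "plane_drawing G p \<gamma> \<longleftrightarrow>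
     inj_on p (verts G) \<and>
     (\<forall>u v. u \<rightarrow>\<^bsub>G\<^esub> v \<longrightarrow>
        arc (\<gamma> {u, v}) \<and>
        {pathstart (\<gamma> {u, v}), pathfinish (\<gamma> {u, v})} = {p u, p v} \<and>
        path_image (\<gamma> {u, v}) \<inter> p ` verts G = {p u, p v}) \<and>
     (\<forall>u v x y. u \<rightarrow>\<^bsub>G\<^esub> v \<longrightarrow> x \<rightarrow>\<^bsub>G\<^esub> y \<longrightarrow> {u, v} \<noteq> {x, y} \<longrightarrow>
        path_image (\<gamma> {u, v}) \<inter> path_image (\<gamma> {x, y}) \<subseteq> p ` ({u, v} \<inter> {x, y}))"

definition planar :: "('a, 'b) pre_digraph \<Rightarrow> bool" where
  "planar G \<longleftrightarrow> (\<exists>p \<gamma>. plane_drawing G p \<gamma>)"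

end

theory Submission
  imports Defs
begin

text \<open>
  Take two adjacent vertices 0 and 1 with three common neighbours 2, 3, 4, and join 3 and 4 by two
  further paths of length three. A set meeting all odd cycles contains 2, 3, 4, or both of 0 and 1,
  or exactly one of 0 and 1. In the last case it must also destroy the two pentagons through the
  other one of them, which takes 3 or 4 (both adjacent to 0 and 1) or one inner vertex of each path.
  Hence two vertices suffice, but three are needed if they are to be independent.

  A path hanging off vertex 2, some of whose vertices carry a leaf, creates no cycles. The leaves can
  be located by counting the vertices at each distance from the triangles, so different sets of
  leaves give non-isomorphic graphs. Unused leaves remain as isolated vertices, which keeps the
  number of vertices fixed.
\<close>

section \<open>Colourings and isomorphisms\<close>

lemma delete_verts_simps:
  "verts (delete_verts G S) = verts G - S"
  "u \<rightarrow>\<^bsub>delete_verts G S\<^esub> v \<longleftrightarrow> u \<rightarrow>\<^bsub>G\<^esub> v \<and> u \<in> verts G - S \<and> v \<in> verts G - S"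
  by (auto simp: delete_verts_def arcs_ends_conv)

lemma chromatic_number_eqI:
  assumes "proper_colouring G k c" and "\<And>j c. proper_colouring G j c \<Longrightarrow> k \<le> j"
  shows "chromatic_number G = k"
  unfolding chromatic_number_def by (rule Least_equality) (use assms in blast)+

lemma proper_colouring_mono: "proper_colouring G j c \<Longrightarrow> j \<le> k \<Longrightarrow> proper_colouring G k c"
  by (auto simp: proper_colouring_def)

lemma chromatic_number_eq_2:
  assumes "proper_colouring G 2 c" "u \<rightarrow>\<^bsub>G\<^esub> v" "u \<in> verts G" "v \<in> verts G"
  shows "chromatic_number G = 2"
proof (rule chromatic_number_eqI[OF assms(1)])
  fix j d assume "proper_colouring G j d"
  then have "d u < j" "d v < j" "d u \<noteq> d v"
    using assms by (auto simp: proper_colouring_def)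
  then show "2 \<le> j" by linarith
qed

lemma chromatic_number_colouring:
  assumes "proper_colouring G k c"
  obtains d where "proper_colouring G (chromatic_number G) d"
proof -
  have "\<exists>d. proper_colouring G (chromatic_number G) d"
    unfolding chromatic_number_def by (rule LeastI_ex) (use assms in blast)
  then show ?thesis using that by blast
qed

lemma no_2_colouring_of_triangle:
  assumes "proper_colouring G 2 c" "{x, y, z} \<subseteq> verts G"
    "x \<rightarrow>\<^bsub>G\<^esub> y" "y \<rightarrow>\<^bsub>G\<^esub> z" "z \<rightarrow>\<^bsub>G\<^esub> x"
  shows False
proof -
  have "c x < 2" "c y < 2" "c z < 2" "c x \<noteq> c y" "c y \<noteq> c z" "c z \<noteq> c x"
    using assms by (auto simp: proper_colouring_def)
  then show False by linarith
qed

lemma no_2_colouring_of_pentagon: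
  assumes "proper_colouring G 2 c" "{x, y, z, u, v} \<subseteq> verts G"
    "x \<rightarrow>\<^bsub>G\<^esub> y" "y \<rightarrow>\<^bsub>G\<^esub> z" "z \<rightarrow>\<^bsub>G\<^esub> u" "u \<rightarrow>\<^bsub>G\<^esub> v" "v \<rightarrow>\<^bsub>G\<^esub> x"
  shows False
proof -
  have "c x < 2" "c y < 2" "c z < 2" "c u < 2" "c v < 2"
    "c x \<noteq> c y" "c y \<noteq> c z" "c z \<noteq> c u" "c u \<noteq> c v" "c v \<noteq> c x"
    using assms by (auto simp: proper_colouring_def)
  then show False by linarith
qed

text \<open>Level 0 collects the vertices lying on triangles, since without loops the three arcs
  have three distinct ends. Level \<open>i\<close> is the ball of radius \<open>i\<close> around
  them. The sizes of these balls are the invariants that separate the constructed graphs.\<close>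

primrec triangle_ball :: "('a, 'b) pre_digraph \<Rightarrow> nat \<Rightarrow> 'a set" where
  "triangle_ball G 0 = {x. \<exists>y z. x \<rightarrow>\<^bsub>G\<^esub> y \<and> y \<rightarrow>\<^bsub>G\<^esub> z \<and> z \<rightarrow>\<^bsub>G\<^esub> x}"
| "triangle_ball G (Suc i) = triangle_ball G i \<union> {y. \<exists>x \<in> triangle_ball G i. x \<rightarrow>\<^bsub>G\<^esub> y}"

lemma triangle_ball_subset_verts:
  assumes "wf_digraph G"
  shows "triangle_ball G i \<subseteq> verts G"
proof (induction i)
  case 0
  show ?case using wf_digraph.tail_in_verts[OF assms] by (auto simp: arcs_ends_conv)
next
  case (Suc i)
  then show ?case using wf_digraph.head_in_verts[OF assms] by (auto simp: arcs_ends_conv)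
qed

text \<open>Only the vertex part \<open>f\<close> of the isomorphism matters. It preserves and
  reflects adjacency on \<open>verts G\<close>, hence carries each ball onto the ball of the same
  radius, and injectivity preserves the size.\<close>

lemma card_triangle_ball_digraph_iso:
  assumes "digraph_iso G H"
  shows "card (triangle_ball G i) = card (triangle_ball H i)"
proof -
  from assms obtain h where h: "pre_digraph.digraph_isomorphism G h" "H = app_iso h G"
    by (auto simp: digraph_iso_def)
  define f where "f = iso_verts h"
  have wf: "wf_digraph G" and inj: "inj_on f (verts G)"
    using h(1) by (auto simp: pre_digraph.digraph_isomorphism_def f_def)
  have in_verts: "u \<in> verts G \<and> v \<in> verts G" if "u \<rightarrow>\<^bsub>G\<^esub> v" for u v
    using that wf by (auto simp: arcs_ends_conv wf_digraph.wellformed)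
  have H: "arcs_ends H = map_prod f f ` arcs_ends G"
    using h(1) by (force simp: h(2) arcs_ends_conv f_def pre_digraph.digraph_isomorphism_def image_iff)
  have adj: "f u \<rightarrow>\<^bsub>H\<^esub> f v \<longleftrightarrow> u \<rightarrow>\<^bsub>G\<^esub> v" if "u \<in> verts G" "v \<in> verts G" for u v
    using that in_verts inj unfolding H by (auto dest!: inj_onD[OF inj])
  have dom: "\<exists>u v. u \<rightarrow>\<^bsub>G\<^esub> v \<and> x = f u \<and> y = f v" if "x \<rightarrow>\<^bsub>H\<^esub> y" for x y
    using that unfolding H by auto
  have "triangle_ball H i = f ` triangle_ball G i"
  proof (induction i)
    case 0
    show ?case
    proof (intro equalityI subsetI)
      fix x assume "x \<in> triangle_ball H 0"
      then obtain y z where "x \<rightarrow>\<^bsub>H\<^esub> y" "y \<rightarrow>\<^bsub>H\<^esub> z" "z \<rightarrow>\<^bsub>H\<^esub> x" by auto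
      then show "x \<in> f ` triangle_ball G 0"
        using dom in_verts adj by (simp add: image_iff) (metis)
    next
      fix x assume "x \<in> f ` triangle_ball G 0"
      then show "x \<in> triangle_ball H 0" using adj in_verts by simp blast
    qed
  next
    case (Suc i)
    have sub: "triangle_ball G i \<subseteq> verts G" by (rule triangle_ball_subset_verts[OF wf])
    have "{y. \<exists>x \<in> triangle_ball H i. x \<rightarrow>\<^bsub>H\<^esub> y} = f ` {y. \<exists>x \<in> triangle_ball G i. x \<rightarrow>\<^bsub>G\<^esub> y}"
    proof (intro equalityI subsetI)
      fix y assume "y \<in> {y. \<exists>x \<in> triangle_ball H i. x \<rightarrow>\<^bsub>H\<^esub> y}"
      then obtain x where x: "x \<in> triangle_ball G i" "f x \<rightarrow>\<^bsub>H\<^esub> y" using Suc by auto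
      then obtain v where "v \<in> verts G" "y = f v" using dom in_verts by blast
      then show "y \<in> f ` {y. \<exists>x \<in> triangle_ball G i. x \<rightarrow>\<^bsub>G\<^esub> y}"
        using x adj sub by blast
    next
      fix y assume "y \<in> f ` {y. \<exists>x \<in> triangle_ball G i. x \<rightarrow>\<^bsub>G\<^esub> y}"
      then show "y \<in> {y. \<exists>x \<in> triangle_ball H i. x \<rightarrow>\<^bsub>H\<^esub> y}"
        using Suc adj in_verts by blast
    qed
    then show ?case using Suc by (simp add: image_Un)
  qed
  moreover have "inj_on f (triangle_ball G i)"
    using inj triangle_ball_subset_verts[OF wf] by (rule inj_on_subset)
  ultimately show ?thesis by (simp add: card_image)
qed

section \<open>The construction\<close>

text \<open>Vertices 0 and 1 are adjacent with common neighbours 2, 3, 4, and the two long paths are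
  3-5-6-4 and 3-7-8-4. Every edge is listed once, smaller end first, so that
  \<open>edge_less\<close> holds for all edges.\<close>

definition core_edges :: "(nat \<times> nat) set" where
  "core_edges = {(0,1), (0,2), (0,3), (0,4), (1,2), (1,3), (1,4),
     (3,5), (5,6), (4,6), (3,7), (7,8), (4,8)}"

text \<open>The odd numbers from 9 on form the hanging path; \<open>x + 1\<close> is the leaf at \<open>x\<close> if \<open>x \<in> B\<close>, and
  isolated otherwise.\<close>

definition edge :: "nat set \<Rightarrow> nat \<Rightarrow> nat \<Rightarrow> bool" where
  "edge B x y \<longleftrightarrow> (x, y) \<in> core_edges \<or> x = 2 \<and> y = 9 \<or>
     odd x \<and> 9 \<le> x \<and> (y = x + 2 \<or> y = x + 1 \<and> x \<in> B)"

text \<open>Restricting to \<open>{..<n}\<close> cuts the infinite path off. Arcs are their own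
  pairs of ends, which excludes parallel arcs.\<close>

definition comb_graph :: "nat \<Rightarrow> nat set \<Rightarrow> (nat, nat \<times> nat) pre_digraph" where
  "comb_graph n B = \<lparr>verts = {..<n},
     arcs = {(x, y). x < n \<and> y < n \<and> (edge B x y \<or> edge B y x)}, tail = fst, head = snd\<rparr>"

lemma verts_comb_graph [simp]: "verts (comb_graph n B) = {..<n}"
  by (simp add: comb_graph_def)

lemma dominates_comb_graph [simp]:
  "x \<rightarrow>\<^bsub>comb_graph n B\<^esub> y \<longleftrightarrow> x < n \<and> y < n \<and> (edge B x y \<or> edge B y x)"
  by (auto simp: comb_graph_def arcs_ends_conv)

lemma edge_less: "edge B x y \<Longrightarrow> x < y"
  by (auto simp: edge_def core_edges_def)

lemma edge_cases:
  assumes "edge B x y"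
  obtains "(x, y) \<in> core_edges" | "x = 2" "y = 9" | "odd x" "9 \<le> x" "y = x + 2"
    | "odd x" "9 \<le> x" "y = x + 1" "x \<in> B"
  using assms by (auto simp: edge_def)

lemma graph_comb_graph: "graph (comb_graph n B)"
proof -
  have "finite {(x, y). x < n \<and> y < n \<and> (edge B x y \<or> edge B y x)}"
    by (rule finite_subset[of _ "{..<n} \<times> {..<n}"]) auto
  then show ?thesis
    by unfold_locales
      (auto simp: comb_graph_def arc_to_ends_def symmetric_conv dest: edge_less)
qed

text \<open>At deleted core vertices the entry of the list is a dummy.\<close>

definition list_colouring :: "nat list \<Rightarrow> nat \<Rightarrow> nat" where
  "list_colouring cs x = (if x < 9 then cs ! x else x div 2 mod 2)"

text \<open>Outside the core, \<open>x div 2\<close> grows by exactly one from an odd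
  \<open>x\<close> to \<open>x + 1\<close> or \<open>x + 2\<close>, so its parity alternates along
  path and leaves. Vertex 9 receives colour 0, which is why vertex 2 must not.\<close>

lemma list_colouring_edge:
  assumes "edge B x y" "x \<notin> S" "y \<notin> S" and "2 \<notin> S \<Longrightarrow> cs ! 2 \<noteq> 0"
    and "\<forall>(x, y) \<in> core_edges. x \<notin> S \<longrightarrow> y \<notin> S \<longrightarrow> cs ! x \<noteq> cs ! y"
  shows "list_colouring cs x \<noteq> list_colouring cs y"
  using assms(1)
proof (cases rule: edge_cases)
  case 1
  then have "x < 9" "y < 9" by (auto simp: core_edges_def)
  then show ?thesis using 1 assms by (auto simp: list_colouring_def)
next
  case 2
  then show ?thesis using assms by (auto simp: list_colouring_def)
next
  case 3
  then show ?thesis by (simp add: list_colouring_def) presburger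
next
  case 4
  then show ?thesis by (simp add: list_colouring_def) presburger
qed

lemma proper_list_colouring:
  assumes "2 \<notin> S \<Longrightarrow> cs ! 2 \<noteq> 0" "2 \<le> k" "\<forall>x<9. x \<notin> S \<longrightarrow> cs ! x < k"
    and "\<forall>(x, y) \<in> core_edges. x \<notin> S \<longrightarrow> y \<notin> S \<longrightarrow> cs ! x \<noteq> cs ! y"
  shows "proper_colouring (delete_verts (comb_graph n B) S) k (list_colouring cs)"
proof -
  have "x div 2 mod 2 < k" for x :: nat using assms(2) by (rule less_le_trans[rotated]) simp
  moreover have "list_colouring cs x \<noteq> list_colouring cs y"
    if "edge B x y" "x \<notin> S" "y \<notin> S" for x y
    using list_colouring_edge[OF that] assms by blast
  ultimately show ?thesis
    using assms(3) unfolding proper_colouring_def delete_verts_simps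
    by (intro conjI ballI allI impI) (simp add: list_colouring_def, force)
qed

lemma less_9_cases: "(x::nat) < 9 \<Longrightarrow> x \<in> {0,1,2,3,4,5,6,7,8}"
  by (simp; linarith)

text \<open>What is left of the core is the hexagon 3-5-6-4-8-7 and the vertex 2, which carries the
  path.\<close>

lemma proper_colouring_delete_01:
  "proper_colouring (delete_verts (comb_graph n B) {0, 1}) 2 (list_colouring [0,1,1,0,1,1,0,1,0])"
  by (rule proper_list_colouring) (auto simp: core_edges_def dest!: less_9_cases)

text \<open>The core shrinks to the three disjoint edges 01, 56 and 78.\<close>

lemma proper_colouring_delete_234:
  "proper_colouring (delete_verts (comb_graph n B) {2, 3, 4}) 2 (list_colouring [0,1,0,0,0,0,1,0,1])"
  by (rule proper_list_colouring) (auto simp: core_edges_def dest!: less_9_cases)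

lemma proper_colouring_comb_graph:
  "proper_colouring (comb_graph n B) 3 (list_colouring [0,1,2,2,2,0,1,0,1])"
proof -
  have "proper_colouring (delete_verts (comb_graph n B) {}) 3 (list_colouring [0,1,2,2,2,0,1,0,1])"
    by (rule proper_list_colouring) (auto simp: core_edges_def dest!: less_9_cases)
  then show ?thesis
    unfolding proper_colouring_def delete_verts_simps by auto
qed

section \<open>Chromatic stability\<close>

context
  fixes n :: nat and B :: "nat set"
  assumes n: "9 \<le> n"
begin

lemma core_dominates:
  assumes "(x, y) \<in> core_edges"
  shows "x \<rightarrow>\<^bsub>comb_graph n B\<^esub> y" "y \<rightarrow>\<^bsub>comb_graph n B\<^esub> x" "x < n" "y < n"
proof -
  have "x < 9" "y < 9" using assms by (auto simp: core_edges_def)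
  then show "x \<rightarrow>\<^bsub>comb_graph n B\<^esub> y" "y \<rightarrow>\<^bsub>comb_graph n B\<^esub> x" "x < n" "y < n"
    using assms n by (auto simp: edge_def)
qed

lemma hits_triangle:
  assumes "proper_colouring (delete_verts (comb_graph n B) S) 2 c" "x \<in> {2, 3, 4}"
  shows "0 \<in> S \<or> 1 \<in> S \<or> x \<in> S"
proof (rule ccontr)
  assume "\<not> ?thesis"
  moreover have "(0, 1) \<in> core_edges" "(1, x) \<in> core_edges" "(0, x) \<in> core_edges"
    using assms(2) by (auto simp: core_edges_def)
  ultimately show False
    by (intro no_2_colouring_of_triangle[OF assms(1), of 0 1 x])
      (auto simp: delete_verts_simps simp del: dominates_comb_graph dest: core_dominates)
qed

text \<open>Either of 0 and 1 closes each long path between 3 and 4 to the 5-cycle \<open>a\<close>,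
  3, \<open>x\<close>, \<open>y\<close>, 4.\<close>

lemma hits_pentagon:
  assumes "proper_colouring (delete_verts (comb_graph n B) S) 2 c" "a \<in> {0, 1}"
    "(x, y) \<in> {(5, 6), (7, 8)}"
  shows "a \<in> S \<or> 3 \<in> S \<or> x \<in> S \<or> y \<in> S \<or> 4 \<in> S"
proof (rule ccontr)
  assume "\<not> ?thesis"
  moreover have "(a, 3) \<in> core_edges" "(3, x) \<in> core_edges" "(x, y) \<in> core_edges"
    "(4, y) \<in> core_edges" "(a, 4) \<in> core_edges"
    using assms(2,3) by (auto simp: core_edges_def)
  ultimately show False
    by (intro no_2_colouring_of_pentagon[OF assms(1), of a 3 x y 4])
      (auto simp: delete_verts_simps simp del: dominates_comb_graph dest: core_dominates)
qed

lemma chromatic_number_comb_graph: "chromatic_number (comb_graph n B) = 3"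
proof (rule chromatic_number_eqI[OF proper_colouring_comb_graph])
  fix j c assume c: "proper_colouring (comb_graph n B) j c"
  show "3 \<le> j"
  proof (rule ccontr)
    assume "\<not> 3 \<le> j"
    then have "proper_colouring (comb_graph n B) 2 c" using c by (auto intro: proper_colouring_mono)
    then have "proper_colouring (delete_verts (comb_graph n B) {}) 2 c"
      unfolding proper_colouring_def delete_verts_simps by auto
    from hits_triangle[OF this, of 2] show False by simp
  qed
qed

lemma chromatic_number_delete_01: "chromatic_number (delete_verts (comb_graph n B) {0, 1}) = 2"
  by (rule chromatic_number_eq_2[OF proper_colouring_delete_01, of 3 5])
    (use core_dominates[of 3 5] in \<open>auto simp: delete_verts_simps core_edges_def\<close>)

lemma chromatic_number_delete_234: "chromatic_number (delete_verts (comb_graph n B) {2, 3, 4}) = 2"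
  by (rule chromatic_number_eq_2[OF proper_colouring_delete_234, of 0 1])
    (use core_dominates[of 0 1] in \<open>auto simp: delete_verts_simps core_edges_def\<close>)

text \<open>A \<open>LEAST\<close> value is attained only if some number of colours works at all.
  Restricting the 3-colouring of the whole graph supplies one.\<close>

lemma stable_set_colouring:
  assumes "chromatic_number (delete_verts (comb_graph n B) S) + 1 = chromatic_number (comb_graph n B)"
  obtains c where "proper_colouring (delete_verts (comb_graph n B) S) 2 c"
proof -
  have "proper_colouring (delete_verts (comb_graph n B) S) 3 (list_colouring [0,1,2,2,2,0,1,0,1])"
    using proper_colouring_comb_graph[of n B]
    unfolding proper_colouring_def delete_verts_simps by auto
  then obtain c where "proper_colouring (delete_verts (comb_graph n B) S)
      (chromatic_number (delete_verts (comb_graph n B) S)) c"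
    by (rule chromatic_number_colouring)
  moreover have "chromatic_number (delete_verts (comb_graph n B) S) = 2"
    using assms chromatic_number_comb_graph by simp
  ultimately show ?thesis using that by simp
qed

text \<open>This case list serves both stability numbers: every case gives two distinct vertices of
  \<open>S\<close>, and the cases without a forced edge inside \<open>S\<close> give three.\<close>

lemma stable_set_contains:
  assumes "proper_colouring (delete_verts (comb_graph n B) S) 2 c"
  obtains "0 \<in> S" "1 \<in> S" | "{2, 3, 4} \<subseteq> S"
    | a where "a \<in> {0, 1}" "a \<in> S" "3 \<in> S \<or> 4 \<in> S"
    | a x y where "a \<in> {0, 1}" "a \<in> S" "x \<in> {5, 6}" "y \<in> {7, 8}" "x \<in> S" "y \<in> S"
proof -
  \<comment> \<open>In the third case \<open>b\<close> is the survivor among 0 and 1. The pentagons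
    through \<open>b\<close> are the ones that still have to be destroyed.\<close>
  consider "0 \<in> S" "1 \<in> S" | "0 \<notin> S" "1 \<notin> S"
    | a b :: nat where "a \<in> {0, 1}" "b \<in> {0, 1}" "a \<in> S" "b \<notin> S"
    by blast
  then show thesis
  proof cases
    case 1
    then show ?thesis by (rule that(1))
  next
    case 2
    then have "{2, 3, 4} \<subseteq> S"
      using hits_triangle[OF assms] by blast
    then show ?thesis by (rule that(2))
  next
    case (3 a b)
    show ?thesis
    proof (cases "3 \<in> S \<or> 4 \<in> S")
      case True
      with 3 show ?thesis by (intro that(3))
    next
      case False
      then have "5 \<in> S \<or> 6 \<in> S" "7 \<in> S \<or> 8 \<in> S"
        using hits_pentagon[OF assms \<open>b \<in> {0, 1}\<close>, of 5 6]
          hits_pentagon[OF assms \<open>b \<in> {0, 1}\<close>, of 7 8] \<open>b \<notin> S\<close>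
        by simp_all
      then obtain x y where "x \<in> {5, 6}" "y \<in> {7, 8}" "x \<in> S" "y \<in> S" by blast
      with 3 show ?thesis by (intro that(4))
    qed
  qed
qed

lemma vs_chi_comb_graph: "vs_chi (comb_graph n B) = 2"
  unfolding vs_chi_def
proof (rule Least_equality)
  show "\<exists>S \<subseteq> verts (comb_graph n B). card S = 2 \<and>
      chromatic_number (delete_verts (comb_graph n B) S) + 1 = chromatic_number (comb_graph n B)"
    using n chromatic_number_comb_graph chromatic_number_delete_01
    by (intro exI[of _ "{0, 1}"]) auto
next
  fix k assume "\<exists>S \<subseteq> verts (comb_graph n B). card S = k \<and>
      chromatic_number (delete_verts (comb_graph n B) S) + 1 = chromatic_number (comb_graph n B)"
  then obtain S c where S: "S \<subseteq> {..<n}" "card S = k"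
    and c: "proper_colouring (delete_verts (comb_graph n B) S) 2 c"
    by (metis stable_set_colouring verts_comb_graph)
  have *: "2 \<le> k" if "a \<in> S" "b \<in> S" "a \<noteq> b" for a b
    using card_mono[of S "{a, b}"] that S finite_subset[of S "{..<n}"] by auto
  from c show "2 \<le> k"
    by (cases rule: stable_set_contains) (auto intro: *)
qed

lemma ivs_chi_comb_graph: "ivs_chi (comb_graph n B) = 3"
  unfolding ivs_chi_def
proof (rule Least_equality)
  have "independent_set (comb_graph n B) {2, 3, 4}"
    using n by (auto simp: independent_set_def edge_def core_edges_def)
  then show "\<exists>S. independent_set (comb_graph n B) S \<and> card S = 3 \<and>
      chromatic_number (delete_verts (comb_graph n B) S) + 1 = chromatic_number (comb_graph n B)"
    using chromatic_number_comb_graph chromatic_number_delete_234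
    by (intro exI[of _ "{2, 3, 4}"]) auto
next
  fix k assume "\<exists>S. independent_set (comb_graph n B) S \<and> card S = k \<and>
      chromatic_number (delete_verts (comb_graph n B) S) + 1 = chromatic_number (comb_graph n B)"
  then obtain S c where S: "independent_set (comb_graph n B) S" "card S = k"
    and c: "proper_colouring (delete_verts (comb_graph n B) S) 2 c"
    by (metis stable_set_colouring verts_comb_graph)
  have "S \<subseteq> {..<n}" using S by (simp add: independent_set_def)
  then have *: "3 \<le> k" if "{a, b, d} \<subseteq> S" "a \<noteq> b" "a \<noteq> d" "b \<noteq> d" for a b d
    using card_mono[of S "{a, b, d}"] that S finite_subset[of S "{..<n}"] by auto
  \<comment> \<open>Independence rules out the cases with both 0 and 1, or with one of them and 3 or
    4. The other two cases supply three distinct vertices for \<open>*\<close>.\<close>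
  have **: False if "(x, y) \<in> core_edges" "x \<in> S" "y \<in> S" for x y
    using S that core_dominates(1)[OF that(1)] unfolding independent_set_def by blast
  from c show "3 \<le> k"
  proof (cases rule: stable_set_contains)
    case 1
    then show ?thesis using **[of 0 1] by (simp add: core_edges_def)
  next
    case 2
    then show ?thesis using *[of 2 3 4] by simp
  next
    case (3 a)
    then show ?thesis using **[of a 3] **[of a 4] by (auto simp: core_edges_def)
  next
    case (4 a x y)
    then show ?thesis using *[of a x y] by auto
  qed
qed

section \<open>Maximum degree\<close>

lemma max_degree_comb_graph: "max_degree (comb_graph n B) = 4"
proof -
  define N where "N x = {y. x < n \<and> y < n \<and> (edge B x y \<or> edge B y x)}" for x
  have deg: "out_degree (comb_graph n B) x = card (N x)" for x
  proof -
    have "out_arcs (comb_graph n B) x = Pair x ` N x"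
      by (auto simp: out_arcs_def comb_graph_def N_def)
    then show ?thesis by (simp add: out_degree_def card_image inj_on_def)
  qed
  have "card (N x) \<le> 4" for x
  proof -
    have "\<exists>ys. N x \<subseteq> set ys \<and> length ys \<le> 4"
    proof (cases "x < 9")
      case True
      \<comment> \<open>Row \<open>x\<close> lists all possible neighbours of the core vertex
        \<open>x\<close>, whatever \<open>n\<close> and \<open>B\<close> are. Vertex 2 may have the
        path vertex 9 as a third neighbour.\<close>
      let ?ys = "[[1,2,3,4], [0,2,3,4], [0,1,9], [0,1,5,7], [0,1,6,8], [3,6], [4,5], [3,8], [4,7]] ! x"
      have "N x \<subseteq> set ?ys" "length ?ys \<le> 4"
        using less_9_cases[OF True] by (auto simp: N_def edge_def core_edges_def)
      then show ?thesis by blast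
    next
      case False
      \<comment> \<open>One list covers both parities: an odd \<open>x\<close> has its path
        neighbours and possibly the leaf \<open>x + 1\<close>, while an even \<open>x\<close> has at
        most \<open>x - 1\<close>. The predecessor of 9 on the path is 2.\<close>
      have "N x \<subseteq> set [if x = 9 then 2 else x - 2, x - 1, x + 1, x + 2]"
        using False by (auto simp: N_def edge_def core_edges_def)
      then show ?thesis by fastforce
    qed
    then obtain ys where "N x \<subseteq> set ys" "length ys \<le> 4" by blast
    then have "card (N x) \<le> card (set ys)" by (intro card_mono) auto
    also have "\<dots> \<le> 4" using card_length[of ys] \<open>length ys \<le> 4\<close> by linarith
    finally show ?thesis .
  qed
  moreover have "N 0 = {1, 2, 3, 4}"
    using n by (auto simp: N_def edge_def core_edges_def)
  then have "card (N 0) = 4" by simp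
  then have "4 \<in> (\<lambda>x. card (N x)) ` {..<n}"
    using n by (intro image_eqI[of _ _ 0]) auto
  ultimately show ?thesis
    unfolding max_degree_def deg by (intro Max_eqI) auto
qed

section \<open>Recovering the set of legs\<close>

lemma triangle_ball_0: "triangle_ball (comb_graph n B) 0 = {0, 1, 2, 3, 4}"
proof (intro equalityI subsetI)
  fix x assume "x \<in> triangle_ball (comb_graph n B) 0"
  then obtain y z where t: "x \<rightarrow>\<^bsub>comb_graph n B\<^esub> y" "y \<rightarrow>\<^bsub>comb_graph n B\<^esub> z" "z \<rightarrow>\<^bsub>comb_graph n B\<^esub> x"
    by auto
  \<comment> \<open>Without 0 and 1 the graph is 2-colourable, so every triangle meets these two
    vertices, whose closed neighbourhoods are both \<open>{0, 1, 2, 3, 4}\<close>.\<close>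
  have "x \<in> {0, 1} \<or> y \<in> {0, 1} \<or> z \<in> {0, 1}"
    using no_2_colouring_of_triangle[OF proper_colouring_delete_01, of x y z n B] t
    unfolding delete_verts_simps verts_comb_graph dominates_comb_graph by blast
  moreover have "b \<in> {0, 1, 2, 3, 4}" if "edge B a b \<or> edge B b a" "a \<in> {0, 1}" for a b
    using that by (auto simp: edge_def core_edges_def)
  ultimately show "x \<in> {0, 1, 2, 3, 4}" using t by auto
next
  have "{0, 1, a} \<subseteq> triangle_ball (comb_graph n B) 0" if "a \<in> {2, 3, 4}" for a
  proof -
    have "(0, 1) \<in> core_edges" "(0, a) \<in> core_edges" "(1, a) \<in> core_edges"
      using that by (auto simp: core_edges_def)
    from this[THEN core_dominates(1)] this[THEN core_dominates(2)] show ?thesis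
      unfolding triangle_ball.simps(1) by blast
  qed
  from this[of 2] this[of 3] this[of 4]
  show "x \<in> triangle_ball (comb_graph n B) 0" if "x \<in> {0, 1, 2, 3, 4}" for x
    using that by blast
qed

text \<open>Closed form of the ball of radius \<open>i + 1\<close>. Radius 1 already covers the core
  and vertex 9; after that \<open>9 + 2 * i\<close> is at distance \<open>i + 1\<close> from the
  triangles and its leaf one step further.\<close>

definition leg_ball :: "nat \<Rightarrow> nat set" where
  "leg_ball i = {x. x < n \<and>
     (x < 9 \<or> odd x \<and> x \<le> 9 + 2 * i \<or> even x \<and> x \<le> 8 + 2 * i \<and> x - 1 \<in> B)}"

text \<open>The vertices at distance exactly \<open>i + 2\<close>: the next path vertex, and the
  leaf at \<open>9 + 2 * i\<close> if there is one.\<close>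

definition leg_layer :: "nat \<Rightarrow> nat set" where
  "leg_layer i = (if 11 + 2 * i < n then {11 + 2 * i} else {}) \<union>
     (if 9 + 2 * i \<in> B \<and> 10 + 2 * i < n then {10 + 2 * i} else {})"

lemma leg_ball_Suc: "leg_ball (Suc i) = leg_ball i \<union> leg_layer i"
proof (intro equalityI subsetI)
  fix x assume x: "x \<in> leg_ball (Suc i)"
  consider "x \<in> leg_ball i" | "odd x" "x \<le> 11 + 2 * i" "\<not> x \<le> 9 + 2 * i"
    | "even x" "x \<le> 10 + 2 * i" "\<not> x \<le> 8 + 2 * i" "x - 1 \<in> B"
    using x by (auto simp: leg_ball_def)
  then show "x \<in> leg_ball i \<union> leg_layer i"
  proof cases
    case 2
    then have "x = 11 + 2 * i" by presburger
    then show ?thesis using x by (simp add: leg_ball_def leg_layer_def)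
  next
    case 3
    then have "x = 10 + 2 * i" by presburger
    then show ?thesis using x 3 by (simp add: leg_ball_def leg_layer_def)
  qed simp
next
  fix x assume "x \<in> leg_ball i \<union> leg_layer i"
  then show "x \<in> leg_ball (Suc i)"
    by (auto simp: leg_ball_def leg_layer_def split: if_splits)
qed

lemma triangle_ball_Suc: "triangle_ball (comb_graph n B) (Suc i) = leg_ball i"
proof (induction i)
  case 0
  let ?T = "{0, 1, 2, 3, 4} :: nat set"
  have "{y. \<exists>x \<in> ?T. x \<rightarrow>\<^bsub>comb_graph n B\<^esub> y} \<subseteq> leg_ball 0"
    by (auto simp: edge_def core_edges_def leg_ball_def)
  moreover have "x \<in> ?T \<union> {y. \<exists>x \<in> ?T. x \<rightarrow>\<^bsub>comb_graph n B\<^esub> y}" if "x \<in> leg_ball 0" for x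
  proof -
    have "x \<in> {0,1,2,3,4,5,6,7,8} \<or> x = 9" "x < n"
      using that less_9_cases[of x] by (auto simp: leg_ball_def)
    then show ?thesis using n by (auto simp: edge_def core_edges_def)
  qed
  moreover have "?T \<subseteq> leg_ball 0" using n by (auto simp: leg_ball_def)
  ultimately show ?case
    unfolding triangle_ball.simps(2) triangle_ball_0 by (meson Un_least equalityI subsetI)
next
  case (Suc i)
  have "{y. \<exists>x \<in> leg_ball i. x \<rightarrow>\<^bsub>comb_graph n B\<^esub> y} \<subseteq> leg_ball (Suc i)"
  proof clarify
    fix x y assume x: "x \<in> leg_ball i" and "x \<rightarrow>\<^bsub>comb_graph n B\<^esub> y"
    then have "y < n" "edge B x y \<or> edge B y x" by auto
    \<comment> \<open>The last alternative covers every step back inside the tail, whether along the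
      path or from a leaf to its path vertex.\<close>
    then consider "y < 9" | "y = 9" | "odd x" "9 \<le> x" "y = x + 2"
      | "odd x" "9 \<le> x" "y = x + 1" "x \<in> B" | "odd y" "y < x"
      by (auto simp: edge_def core_edges_def)
    then show "y \<in> leg_ball (Suc i)"
      using x \<open>y < n\<close> by cases (auto simp: leg_ball_def)
  qed
  moreover have "leg_layer i \<subseteq> {y. \<exists>x \<in> leg_ball i. x \<rightarrow>\<^bsub>comb_graph n B\<^esub> y}"
  proof clarify
    fix x assume "x \<in> leg_layer i"
    then have "9 + 2 * i \<in> leg_ball i" "(9 + 2 * i) \<rightarrow>\<^bsub>comb_graph n B\<^esub> x"
      by (auto simp: leg_ball_def leg_layer_def edge_def split: if_splits)
    then show "\<exists>x' \<in> leg_ball i. x' \<rightarrow>\<^bsub>comb_graph n B\<^esub> x" by blast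
  qed
  ultimately show ?case
    unfolding triangle_ball.simps(2)[of _ "Suc i"] Suc.IH leg_ball_Suc by blast
qed

text \<open>The first increment does not depend on \<open>B\<close>, so the growth of the balls
  reveals whether \<open>9 + 2 * i\<close> lies in \<open>B\<close> as soon as its leaf fits below
  \<open>n\<close>.\<close>

lemma card_triangle_ball_step:
  "card (triangle_ball (comb_graph n B) (Suc (Suc i))) =
     card (triangle_ball (comb_graph n B) (Suc i)) +
     (if 11 + 2 * i < n then 1 else 0) + (if 9 + 2 * i \<in> B \<and> 10 + 2 * i < n then 1 else 0)"
proof -
  have "leg_ball i \<inter> leg_layer i = {}"
    by (auto simp: leg_ball_def leg_layer_def)
  moreover have "finite (leg_ball i)" "finite (leg_layer i)"
    by (auto simp: leg_ball_def leg_layer_def)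
  ultimately have "card (leg_ball (Suc i)) = card (leg_ball i) + card (leg_layer i)"
    unfolding leg_ball_Suc by (simp add: card_Un_disjoint)
  then show ?thesis unfolding triangle_ball_Suc by (auto simp: leg_layer_def)
qed

end

section \<open>Planarity\<close>

text \<open>The core lies in the half-plane \<open>Re z \<le> 0\<close>, touching its boundary only in vertex 2, and the
  tail in \<open>Re z \<ge> 0\<close>.\<close>

definition position :: "nat \<Rightarrow> complex" where
  "position x = (if x < 9 then [Complex (-1) 8, Complex (-1) (-8), Complex 0 0, Complex (-5) 0,
       Complex (-2) 0, Complex (-4) 1, Complex (-3) 1, Complex (-4) (-1), Complex (-3) (-1)] ! x
     else if odd x then Complex (real x - 7) 0 else Complex (real x - 8) 1)"

section \<open>Segments of the core and placement of the vertices\<close>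

lemma closed_segment_complexE:
  assumes "z \<in> closed_segment a b"
  obtains u where "0 \<le> u" "u \<le> 1"
    "Re z = Re a + u * (Re b - Re a)" "Im z = Im a + u * (Im b - Im a)"
proof -
  obtain u where u: "0 \<le> u" "u \<le> 1" "z = (1 - u) *\<^sub>R a + u *\<^sub>R b"
    using assms by (auto simp: in_segment)
  show ?thesis by (rule that[OF u(1,2)]) (simp_all add: u(3) algebra_simps)
qed

lemma position_core:
  "position 0 = Complex (-1) 8" "position (Suc 0) = Complex (-1) (-8)" "position 2 = Complex 0 0"
  "position 3 = Complex (-5) 0" "position 4 = Complex (-2) 0" "position 5 = Complex (-4) 1"
  "position 6 = Complex (-3) 1" "position 7 = Complex (-4) (-1)" "position 8 = Complex (-3) (-1)"
  by (simp_all add: position_def)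

text \<open>Eliminating the parameter of each segment leaves a line equation with bounds, so that
  all incidence questions in the core become linear arithmetic.\<close>

lemma core_segment_cases:
  assumes "(x, y) \<in> core_edges" "z \<in> closed_segment (position x) (position y)"
  shows
   "x = 0 \<and> y = 1 \<and> Re z = -1 \<and> -8 \<le> Im z \<and> Im z \<le> 8 \<or>
    x = 0 \<and> y = 2 \<and> Im z = -8 * Re z \<and> -1 \<le> Re z \<and> Re z \<le> 0 \<or>
    x = 0 \<and> y = 3 \<and> Im z = 2 * Re z + 10 \<and> -5 \<le> Re z \<and> Re z \<le> -1 \<or>
    x = 0 \<and> y = 4 \<and> Im z = 8 * Re z + 16 \<and> -2 \<le> Re z \<and> Re z \<le> -1 \<or>
    x = 1 \<and> y = 2 \<and> Im z = 8 * Re z \<and> -1 \<le> Re z \<and> Re z \<le> 0 \<or>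
    x = 1 \<and> y = 3 \<and> Im z = -2 * Re z - 10 \<and> -5 \<le> Re z \<and> Re z \<le> -1 \<or>
    x = 1 \<and> y = 4 \<and> Im z = -8 * Re z - 16 \<and> -2 \<le> Re z \<and> Re z \<le> -1 \<or>
    x = 3 \<and> y = 5 \<and> Im z = Re z + 5 \<and> -5 \<le> Re z \<and> Re z \<le> -4 \<or>
    x = 5 \<and> y = 6 \<and> Im z = 1 \<and> -4 \<le> Re z \<and> Re z \<le> -3 \<or>
    x = 4 \<and> y = 6 \<and> Im z = -2 - Re z \<and> -3 \<le> Re z \<and> Re z \<le> -2 \<or>
    x = 3 \<and> y = 7 \<and> Im z = -5 - Re z \<and> -5 \<le> Re z \<and> Re z \<le> -4 \<or>
    x = 7 \<and> y = 8 \<and> Im z = -1 \<and> -4 \<le> Re z \<and> Re z \<le> -3 \<or>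
    x = 4 \<and> y = 8 \<and> Im z = Re z + 2 \<and> -3 \<le> Re z \<and> Re z \<le> -2"
proof -
  obtain u where u: "0 \<le> u" "u \<le> 1"
    "Re z = Re (position x) + u * (Re (position y) - Re (position x))"
    "Im z = Im (position x) + u * (Im (position y) - Im (position x))"
    by (rule closed_segment_complexE[OF assms(2)])
  show ?thesis
    using assms(1) u unfolding core_edges_def
    by (elim insertE emptyE Pair_inject; hypsubst) (simp add: position_core)+
qed

lemma core_segments_meet:
  assumes "(x, y) \<in> core_edges" "(x', y') \<in> core_edges" "(x, y) \<noteq> (x', y')"
    and "z \<in> closed_segment (position x) (position y)"
    and "z \<in> closed_segment (position x') (position y')"
  shows "z \<in> position ` ({x, y} \<inter> {x', y'})"
  by (insert core_segment_cases[OF assms(1,4)] core_segment_cases[OF assms(2,5)] assms(3),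
      elim disjE conjE) (simp_all add: position_core complex_eq_iff)

lemma position_tail:
  "odd x \<Longrightarrow> 9 \<le> x \<Longrightarrow> position x = Complex (real x - 7) 0"
  "even x \<Longrightarrow> 9 \<le> x \<Longrightarrow> position x = Complex (real x - 8) 1"
  by (simp_all add: position_def)

lemma position_cases:
  obtains "v < 9" "Re (position v) \<le> 0" "Re (position v) = 0 \<Longrightarrow> v = 2"
    | "odd v" "9 \<le> v" "Re (position v) = real v - 7" "Im (position v) = 0"
    | "even v" "10 \<le> v" "Re (position v) = real v - 8" "Im (position v) = 1"
proof (cases "v < 9")
  case True
  have "Re (position v) \<le> 0" "Re (position v) = 0 \<Longrightarrow> v = 2"
    using less_9_cases[OF True] by (auto simp: position_core)
  then show ?thesis using True that(1) by blast
next
  case False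
  show ?thesis
  proof (cases "odd v")
    case True
    then show ?thesis using False that(2) by (simp add: position_tail)
  next
    case even: False
    then have "10 \<le> v" using False by presburger
    then show ?thesis using even that(3) by (simp add: position_tail)
  qed
qed

lemma inj_position: "inj position"
proof (rule injI)
  fix x y assume eq: "position x = position y"
  show "x = y"
  proof (cases "x < 9 \<and> y < 9")
    case True
    then have "x \<in> {0,1,2,3,4,5,6,7,8}" "y \<in> {0,1,2,3,4,5,6,7,8}"
      using less_9_cases by blast+
    then show ?thesis using eq by (auto simp: position_core)
  next
    case False
    then have "9 \<le> x \<or> 9 \<le> y" by auto
    moreover have "Re (position x) = Re (position y)" "Im (position x) = Im (position y)"
      using eq by simp_all
    ultimately show ?thesis
      by (cases x rule: position_cases; cases y rule: position_cases) linarith+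
  qed
qed

text \<open>This separates core and tail: a point common to both can only be
  \<open>position 2\<close>.\<close>

lemma core_segment_left:
  assumes "(x, y) \<in> core_edges" "z \<in> closed_segment (position x) (position y)"
  shows "Re z \<le> 0" "Re z = 0 \<Longrightarrow> z = position 2 \<and> 2 \<in> {x, y}"
proof -
  have "Re z \<le> 0 \<and> (Re z = 0 \<longrightarrow> z = position 2 \<and> 2 \<in> {x, y})"
    by (insert core_segment_cases[OF assms], elim disjE conjE)
      (simp_all add: position_core complex_eq_iff)
  then show "Re z \<le> 0" "Re z = 0 \<Longrightarrow> z = position 2 \<and> 2 \<in> {x, y}" by blast+
qed

lemma core_segment_vertex:
  assumes "(x, y) \<in> core_edges" "position v \<in> closed_segment (position x) (position y)"
  shows "v \<in> {x, y}"
proof (cases "v < 9")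
  case True
  have "v = 0 \<or> v = 1 \<or> v = 2 \<or> v = 3 \<or> v = 4 \<or> v = 5 \<or> v = 6 \<or> v = 7 \<or> v = 8"
    using less_9_cases[OF True] by simp
  then show ?thesis
    by (insert core_segment_cases[OF assms], elim disjE conjE)
      (simp_all add: position_core)
next
  case False
  then show ?thesis
    using core_segment_left(1)[OF assms] by (cases v rule: position_cases) auto
qed

section \<open>Segments of the tail\<close>

lemma tail_segment_cases:
  assumes "edge B x y" "(x, y) \<notin> core_edges" "z \<in> closed_segment (position x) (position y)"
  obtains "x = 2" "y = 9" "Im z = 0" "0 \<le> Re z" "Re z \<le> 2"
    | "odd x" "9 \<le> x" "y = x + 2" "Im z = 0" "real x - 7 \<le> Re z" "Re z \<le> real x - 5"
    | "odd x" "9 \<le> x" "y = x + 1" "Re z = real x - 7" "0 \<le> Im z" "Im z \<le> 1"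
proof -
  obtain u where u: "0 \<le> u" "u \<le> 1"
    "Re z = Re (position x) + u * (Re (position y) - Re (position x))"
    "Im z = Im (position x) + u * (Im (position y) - Im (position x))"
    by (rule closed_segment_complexE[OF assms(3)])
  from assms(1) show thesis
  proof (cases rule: edge_cases)
    case 1
    then show ?thesis using assms(2) by simp
  next
    case 2
    then show ?thesis using u that(1) by (simp add: position_core position_tail)
  next
    case 3
    then show ?thesis using u that(2) by (simp add: position_tail)
  next
    case 4
    then show ?thesis using u that(3) by (simp add: position_tail)
  qed
qed

lemma edge_segment_vertex:
  assumes "edge B x y" "position v \<in> closed_segment (position x) (position y)"
  shows "v \<in> {x, y}"
proof (cases "(x, y) \<in> core_edges")
  case True
  then show ?thesis using assms(2) by (rule core_segment_vertex)
next
  case False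
  from assms(1) False assms(2) show ?thesis
  proof (cases rule: tail_segment_cases)
    case 1
    then show ?thesis by (cases v rule: position_cases) auto
  next
    case 2
    show ?thesis
    proof (cases v rule: position_cases)
      case v: 2
      \<comment> \<open>Parity excludes \<open>x + 1\<close>, since \<open>v\<close> and
        \<open>x\<close> are both odd.\<close>
      then have "v = x \<or> v = x + 1 \<or> v = x + 2" using 2 by auto
      then show ?thesis using 2 v by auto
    qed (use 2 in auto)
  next
    case 3
    then show ?thesis by (cases v rule: position_cases) auto
  qed
qed

lemma core_tail_segments_meet:
  assumes "(x, y) \<in> core_edges" "edge B x' y'" "(x', y') \<notin> core_edges"
    and "z \<in> closed_segment (position x) (position y)"
    and "z \<in> closed_segment (position x') (position y')"
  shows "z \<in> position ` ({x, y} \<inter> {x', y'})"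
proof -
  note core = core_segment_left[OF assms(1,4)]
  from assms(2,3,5) show ?thesis
  proof (cases rule: tail_segment_cases)
    case 1
    then show ?thesis using core by auto
  qed (use core in auto)
qed

text \<open>Overlapping ranges of \<open>Re z\<close> give \<open>x' \<le> x + 2\<close>, and parity
  makes this an equality. The ranges then share a single value.\<close>

lemma spine_segments_meet:
  assumes "odd x" "9 \<le> x" "odd x'" "9 \<le> x'" "x < x'" "Im z = 0" "Re z \<le> real x - 5" "real x' - 7 \<le> Re z"
  shows "x' = x + 2 \<and> z = position x'"
proof -
  have "x' \<noteq> x + 1" using assms by auto
  then have "x' = x + 2" using assms by auto
  then show ?thesis using assms by (auto simp: position_tail complex_eq_iff)
qed

lemma tail_segments_meet:
  assumes e: "edge B x y" "(x, y) \<notin> core_edges" "z \<in> closed_segment (position x) (position y)"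
    and e': "edge B x' y'" "(x', y') \<notin> core_edges" "z \<in> closed_segment (position x') (position y')"
    and ne: "(x, y) \<noteq> (x', y')"
  shows "z \<in> position ` ({x, y} \<inter> {x', y'})"
proof -
  \<comment> \<open>A leg can touch the spine only at its foot \<open>b\<close>. By parity
    \<open>b\<close> is an end of the spine segment, not the point halfway along it.\<close>
  have spine_leg: "z \<in> position ` ({a, a + 2} \<inter> {b, b + 1})"
    if "odd a" "9 \<le> a" "odd b" "9 \<le> b" "Im z = 0" "real a - 7 \<le> Re z" "Re z \<le> real a - 5"
      "Re z = real b - 7" for a b
  proof -
    have "b \<noteq> a + 1" "z = position b" using that by (auto simp: position_tail complex_eq_iff)
    then show ?thesis using that by auto
  qed
  \<comment> \<open>The segment from 2 to 9 ends at real part 2, which other tail segments reach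
    only if they start at vertex 9.\<close>
  have first: "z \<in> position ` ({2, 9} \<inter> {b, c})"
    if "9 \<le> b" "odd b" "Im z = 0" "Re z \<le> 2" "real b - 7 \<le> Re z" for b c
  proof -
    have "b = 9" "Re z = 2" using that by linarith+
    then show ?thesis using that by (auto simp: position_tail complex_eq_iff)
  qed
  from e show ?thesis
  proof (cases rule: tail_segment_cases)
    case 1
    note x = this
    from e' show ?thesis
    proof (cases rule: tail_segment_cases)
      case 1
      then show ?thesis using x ne by simp
    qed (use x first[of x' y'] in simp_all)
  next
    case 2
    note x = this
    from e' show ?thesis
    proof (cases rule: tail_segment_cases)
      case 1
      then show ?thesis using x first[of x y] by (simp add: Int_commute)
    next
      case 2
      then have "x < x' \<or> x' < x" using x ne by auto
      then show ?thesis using x 2 spine_segments_meet[of x x' z] spine_segments_meet[of x' x z] by auto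
    next
      case 3
      then show ?thesis using x spine_leg[of x x'] by simp
    qed
  next
    case 3
    note x = this
    from e' show ?thesis
    proof (cases rule: tail_segment_cases)
      case 1
      then show ?thesis using x first[of x y] by (simp add: Int_commute)
    next
      case 2
      then show ?thesis using x spine_leg[of x' x] by (simp add: Int_commute)
    next
      case 3
      then show ?thesis using x ne by simp
    qed
  qed
qed

lemma edge_segments_meet:
  assumes "edge B x y" "edge B x' y'" "(x, y) \<noteq> (x', y')"
    and "z \<in> closed_segment (position x) (position y)"
    and "z \<in> closed_segment (position x') (position y')"
  shows "z \<in> position ` ({x, y} \<inter> {x', y'})"
proof (cases "(x, y) \<in> core_edges"; cases "(x', y') \<in> core_edges")
  assume "(x, y) \<in> core_edges" "(x', y') \<in> core_edges"
  then show ?thesis using assms(3-5) by (rule core_segments_meet)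
next
  assume "(x, y) \<in> core_edges" "(x', y') \<notin> core_edges"
  then show ?thesis using core_tail_segments_meet assms by blast
next
  assume "(x, y) \<notin> core_edges" "(x', y') \<in> core_edges"
  then have "z \<in> position ` ({x', y'} \<inter> {x, y})" using core_tail_segments_meet assms by blast
  then show ?thesis by (simp only: Int_commute)
next
  assume "(x, y) \<notin> core_edges" "(x', y') \<notin> core_edges"
  then show ?thesis using tail_segments_meet assms by blast
qed

section \<open>The straight-line drawing\<close>

lemma planar_comb_graph: "planar (comb_graph n B)"
proof -
  \<comment> \<open>A drawing assigns curves to unordered pairs. \<open>Min\<close> and
    \<open>Max\<close> restore the orientation of \<open>edge\<close>, in which the smaller end
    comes first.\<close>
  define \<gamma> where "\<gamma> e = linepath (position (Min e)) (position (Max e))" for e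
  have \<gamma>: "\<gamma> {u, v} = linepath (position u) (position v)" if "edge B u v" for u v
    using edge_less[OF that] by (simp add: \<gamma>_def)
  have arcs: "arc (\<gamma> {u, v}) \<and> {pathstart (\<gamma> {u, v}), pathfinish (\<gamma> {u, v})} = {position u, position v} \<and>
      path_image (\<gamma> {u, v}) \<inter> position ` verts (comb_graph n B) = {position u, position v}"
    if e: "edge B u v" "u < n" "v < n" for u v
  proof -
    have "position u \<noteq> position v" using edge_less[OF e(1)] inj_position by (auto dest: injD)
    then show ?thesis
      using edge_segment_vertex[OF e(1)] e(2,3) by (auto simp: \<gamma>[OF e(1)] arc_linepath)
  qed
  have meet: "path_image (\<gamma> {u, v}) \<inter> path_image (\<gamma> {x, y}) \<subseteq> position ` ({u, v} \<inter> {x, y})"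
    if "edge B u v" "edge B x y" "{u, v} \<noteq> {x, y}" for u v x y
    using edge_segments_meet[OF that(1,2)] that(3) by (auto simp: \<gamma>[OF that(1)] \<gamma>[OF that(2)])
  have "plane_drawing (comb_graph n B) position \<gamma>"
    unfolding plane_drawing_def
  proof (intro conjI allI impI)
    show "inj_on position (verts (comb_graph n B))"
      using inj_position by (rule inj_on_subset) simp
  next
    fix u v assume "u \<rightarrow>\<^bsub>comb_graph n B\<^esub> v"
    \<comment> \<open>The arc may run against \<open>edge\<close>. Everything is stated through the
      set \<open>{u, v}\<close>, so passing to the oriented pair loses nothing.\<close>
    then obtain a b where "edge B a b" "a < n" "b < n" and ab: "{a, b} = {u, v}" by auto
    with arcs[of a b] have "arc (\<gamma> {u, v}) \<and>
      {pathstart (\<gamma> {u, v}), pathfinish (\<gamma> {u, v})} = position ` {u, v} \<and>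
      path_image (\<gamma> {u, v}) \<inter> position ` verts (comb_graph n B) = position ` {u, v}"
      unfolding ab[symmetric] by simp
    then show "arc (\<gamma> {u, v})"
      "{pathstart (\<gamma> {u, v}), pathfinish (\<gamma> {u, v})} = {position u, position v}"
      "path_image (\<gamma> {u, v}) \<inter> position ` verts (comb_graph n B) = {position u, position v}"
      by simp_all
  next
    fix u v x y assume "u \<rightarrow>\<^bsub>comb_graph n B\<^esub> v" "x \<rightarrow>\<^bsub>comb_graph n B\<^esub> y" and ne: "{u, v} \<noteq> {x, y}"
    then obtain a b c d where "edge B a b" "edge B c d" and ab: "{a, b} = {u, v}" "{c, d} = {x, y}"
      by auto
    then show "path_image (\<gamma> {u, v}) \<inter> path_image (\<gamma> {x, y}) \<subseteq> position ` ({u, v} \<inter> {x, y})"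
      using ne meet[of a b c d] unfolding ab by simp
  qed
  then show ?thesis unfolding planar_def by blast
qed

section \<open>Counting\<close>

text \<open>The bound \<open>i < (n - 9) div 2\<close> says exactly that the leaf
  \<open>10 + 2 * i\<close> is a vertex, so each member of a leg set really carries a leaf.\<close>

definition leg_sets :: "nat \<Rightarrow> nat set set" where
  "leg_sets n = Pow ((\<lambda>i. 9 + 2 * i) ` {..<(n - 9) div 2})"

lemma card_leg_sets: "card (leg_sets n) = 2 ^ ((n - 9) div 2)"
  by (simp add: leg_sets_def card_Pow card_image inj_on_def)

text \<open>Used twice: for equal graphs it gives injectivity of the construction, for isomorphic
  graphs it gives pairwise non-isomorphism.\<close>

lemma leg_sets_eqI:
  assumes "9 \<le> n" "B \<in> leg_sets n" "B' \<in> leg_sets n"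
    and eq: "\<And>i. card (triangle_ball (comb_graph n B) i) = card (triangle_ball (comb_graph n B') i)"
  shows "B = B'"
proof -
  have *: "9 + 2 * i \<in> B \<longleftrightarrow> 9 + 2 * i \<in> B'" if "i < (n - 9) div 2" for i
  proof -
    have "10 + 2 * i < n" using that by linarith
    then show ?thesis
      using card_triangle_ball_step[OF assms(1), of B i] card_triangle_ball_step[OF assms(1), of B' i]
      by (simp add: eq del: triangle_ball.simps split: if_splits)
  qed
  have "x \<in> B \<longleftrightarrow> x \<in> B'" for x
  proof (cases "x \<in> (\<lambda>i. 9 + 2 * i) ` {..<(n - 9) div 2}")
    case True
    then show ?thesis using * by auto
  next
    case False
    then show ?thesis using assms(2,3) unfolding leg_sets_def by blast
  qed
  then show ?thesis by blast
qed

theorem theorem3: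
  fixes n :: nat
  assumes "n \<ge> 9"
  shows "\<exists>\<G> :: (nat, nat \<times> nat) pre_digraph set.
     max 1 ((2::real) powi \<lfloor>(real n - 11) / 2\<rfloor>) \<le> real (card \<G>) \<and>
     (\<forall>G \<in> \<G>. graph G \<and> planar G \<and> card (verts G) = n \<and>
        chromatic_number G = 3 \<and> max_degree G = 4 \<and> ivs_chi G = 3 \<and> vs_chi G = 2) \<and>
     pairwise (\<lambda>G H. \<not> digraph_iso G H) \<G>"
proof (intro exI conjI)
  let ?\<G> = "comb_graph n ` leg_sets n"
  have "inj_on (comb_graph n) (leg_sets n)"
    using leg_sets_eqI[OF assms] by (intro inj_onI) simp
  then have card: "card ?\<G> = 2 ^ ((n - 9) div 2)"
    by (simp add: card_image card_leg_sets)
  \<comment> \<open>For \<open>n\<close> equal to 9 or 10 the floor is -1 and the power is 1/2. The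
    term 1 of the maximum is then covered because a natural power of 2 is at least 1.\<close>
  have "\<lfloor>(real n - 11) / 2\<rfloor> \<le> int ((n - 9) div 2)"
  proof -
    have "n \<le> 2 * ((n - 9) div 2) + 10" by linarith
    then have "real n \<le> 2 * real ((n - 9) div 2) + 10" by linarith
    then show ?thesis unfolding floor_le_iff by simp
  qed
  then have "(2::real) powi \<lfloor>(real n - 11) / 2\<rfloor> \<le> 2 powi int ((n - 9) div 2)"
    by (rule power_int_increasing) simp_all
  then show "max 1 ((2::real) powi \<lfloor>(real n - 11) / 2\<rfloor>) \<le> real (card ?\<G>)"
    unfolding card by simp
  show "\<forall>G \<in> ?\<G>. graph G \<and> planar G \<and> card (verts G) = n \<and>
      chromatic_number G = 3 \<and> max_degree G = 4 \<and> ivs_chi G = 3 \<and> vs_chi G = 2"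
    using graph_comb_graph planar_comb_graph chromatic_number_comb_graph[OF assms]
      max_degree_comb_graph[OF assms] ivs_chi_comb_graph[OF assms] vs_chi_comb_graph[OF assms]
    by simp
  show "pairwise (\<lambda>G H. \<not> digraph_iso G H) ?\<G>"
    unfolding pairwise_def
    using leg_sets_eqI[OF assms] card_triangle_ball_digraph_iso by blast
qed

end
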